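(* For all $n\ge1$, the chromatic number of the parity-constrained Hanoi graph is $\chi(P^n)=3$.
   Context: Let $Q=\{0,1,2,3\}$ (pegs: $0,3$ neutral; $1$ reserved for even discs; $2$ reserved for odd discs). For a disc $d\in\{1,\dots,n\}$ let $p(d)=1$ if $d$ is even and $p(d)=2$ if $d$ is odd, and $Q^d=\{0,p(d),3\}$. The vertices of $P^n$ are words $s=s_n\cdots s_1\in Q^n$ ($s_d$ is the peg of disc $d$) with $s_d\in Q^d$ for all $d$. Two vertices are adjacent iff they differ in exactly one coordinate $d$, with values $i\ne j$ there, $i,j\in Q^d$, and $s_k\notin\{i,j\}$ for all $k<d$. *)

theory Defs
  imports Main "HOL-Library.FuncSet"
begin

text \<open>A simple graph is given by a vertex set \<open>V\<close> and a symmetric irreflexive relation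
  \<open>adj\<close> on \<open>V\<close>.\<close>

definition proper_colouring :: "'a set \<Rightarrow> ('a \<Rightarrow> 'a \<Rightarrow> bool) \<Rightarrow> nat \<Rightarrow> ('a \<Rightarrow> nat) \<Rightarrow> bool" where
  "proper_colouring V adj k c \<longleftrightarrow>
     (\<forall>v\<in>V. c v < k) \<and> (\<forall>u\<in>V. \<forall>v\<in>V. adj u v \<longrightarrow> c u \<noteq> c v)"

text \<open>Meaningful for finite graphs (more generally, for graphs with some finite proper colouring),
  where the minimum exists.\<close>

definition chromatic_number :: "'a set \<Rightarrow> ('a \<Rightarrow> 'a \<Rightarrow> bool) \<Rightarrow> nat" where
  "chromatic_number V adj = (LEAST k. \<exists>c. proper_colouring V adj k c)"

definition parity_peg :: "nat \<Rightarrow> nat" where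
  "parity_peg d = (if even d then 1 else 2)"

definition pegs :: "nat \<Rightarrow> nat set" where
  "pegs d = {0, parity_peg d, 3}"

text \<open>The word \<open>s\<^sub>n \<dots> s\<^sub>1\<close> is encoded as the function \<open>d \<mapsto> s\<^sub>d\<close> on \<open>{1..n}\<close>, made
  \<open>undefined\<close> outside that set so that distinct functions are distinct words.\<close>

definition hanoi_verts :: "nat \<Rightarrow> (nat \<Rightarrow> nat) set" where
  "hanoi_verts n = (\<Pi>\<^sub>E d\<in>{1..n}. pegs d)"

definition hanoi_adj :: "nat \<Rightarrow> (nat \<Rightarrow> nat) \<Rightarrow> (nat \<Rightarrow> nat) \<Rightarrow> bool" where
  "hanoi_adj n s t \<longleftrightarrow>
     s \<in> hanoi_verts n \<and> t \<in> hanoi_verts n \<and>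
     (\<exists>d\<in>{1..n}. s d \<noteq> t d \<and>
        (\<forall>k\<in>{1..n}. k \<noteq> d \<longrightarrow> s k = t k) \<and>
        (\<forall>k\<in>{1..<d}. s k \<notin> {s d, t d}))"

lemma hanoi_adj_sym: "hanoi_adj n s t \<Longrightarrow> hanoi_adj n t s"
  unfolding hanoi_adj_def by (elim conjE bexE, intro conjI) (auto intro!: bexI)

lemma hanoi_adj_irrefl: "\<not> hanoi_adj n s s"
  by (simp add: hanoi_adj_def)

lemma finite_hanoi_verts: "finite (hanoi_verts n)"
  by (simp add: hanoi_verts_def pegs_def finite_PiE)

end

theory Submission
  imports Defs
begin

text \<open>Every move changes exactly one letter of the word, and each letter takes three values.
  Identifying these with the residues modulo 3 therefore makes the sum of the letters modulo 3
  a proper 3-colouring. Conversely, the smallest disc moves freely, so its three positions above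
  a fixed configuration of the other discs form a triangle.\<close>

text \<open>On each \<open>pegs d\<close> the map \<open>x \<mapsto> (x + 1) div 2\<close> is a bijection onto \<open>{0, 1, 2}\<close>.\<close>

definition peg_sum :: "nat \<Rightarrow> (nat \<Rightarrow> nat) \<Rightarrow> nat" where
  "peg_sum n s = (\<Sum>d\<in>{1..n}. (s d + 1) div 2)"

text \<open>Adding \<open>a\<close> is injective modulo 3, and \<open>(x + 1) div 2\<close> takes
  distinct values below 3 on \<open>pegs d\<close>: pegs 1 and 2, which share the value 1, never lie
  in the same \<open>pegs d\<close>.\<close>

lemma peg_residue_neq:
  assumes "x \<in> pegs d" "y \<in> pegs d" "x \<noteq> y"
  shows "(a + (x + 1) div 2) mod 3 \<noteq> (a + (y + 1) div 2) mod 3"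
  using assms unfolding pegs_def parity_peg_def
  by (auto split: if_splits) presburger+

lemma proper_colouring_peg_sum:
  "proper_colouring (hanoi_verts n) (hanoi_adj n) 3 (\<lambda>s. peg_sum n s mod 3)"
  unfolding proper_colouring_def
proof (intro conjI ballI impI)
  fix s t
  assume "hanoi_adj n s t"
  then obtain d where s: "s \<in> hanoi_verts n" and t: "t \<in> hanoi_verts n" and d: "d \<in> {1..n}"
    and neq: "s d \<noteq> t d" and eq: "\<And>k. k \<in> {1..n} \<Longrightarrow> k \<noteq> d \<Longrightarrow> s k = t k"
    unfolding hanoi_adj_def by blast
  have "s d \<in> pegs d" "t d \<in> pegs d"
    using s t d unfolding hanoi_verts_def by (blast dest: PiE_mem)+
  \<comment> \<open>\<open>a\<close> is the contribution of the discs that stay put, common to both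
    words.\<close>
  moreover define a where "a = (\<Sum>k\<in>{1..n} - {d}. (s k + 1) div 2)"
  moreover have "peg_sum n s = a + (s d + 1) div 2"
    unfolding peg_sum_def a_def using d by (simp add: sum.remove)
  moreover have "a = (\<Sum>k\<in>{1..n} - {d}. (t k + 1) div 2)"
    unfolding a_def using eq by (intro sum.cong) auto
  then have "peg_sum n t = a + (t d + 1) div 2"
    unfolding peg_sum_def using d by (simp add: sum.remove)
  ultimately show "peg_sum n s mod 3 \<noteq> peg_sum n t mod 3"
    using neq peg_residue_neq by metis
qed simp

text \<open>Peg 0 is open to discs of either parity, so all larger discs can be parked
  there.\<close>

definition smallest_disc_at :: "nat \<Rightarrow> nat \<Rightarrow> nat \<Rightarrow> nat" where
  "smallest_disc_at n x = (\<lambda>d\<in>{1..n}. if d = 1 then x else 0)"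

lemma smallest_disc_at_in_hanoi_verts:
  "x \<in> pegs 1 \<Longrightarrow> smallest_disc_at n x \<in> hanoi_verts n"
  unfolding smallest_disc_at_def hanoi_verts_def by (auto simp: pegs_def)

lemma hanoi_adj_smallest_disc_at:
  assumes "n \<ge> 1" "x \<in> pegs 1" "y \<in> pegs 1" "x \<noteq> y"
  shows "hanoi_adj n (smallest_disc_at n x) (smallest_disc_at n y)"
  unfolding hanoi_adj_def
  using assms smallest_disc_at_in_hanoi_verts
  \<comment> \<open>With disc 1 as the moving disc, no smaller disc can block the move.\<close>
  by (auto simp: smallest_disc_at_def intro!: bexI[of _ 1])

lemma proper_colouring_hanoi_ge_3:
  assumes "n \<ge> 1" and c: "proper_colouring (hanoi_verts n) (hanoi_adj n) k c"
  shows "3 \<le> k"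
proof -
  let ?f = "\<lambda>x. c (smallest_disc_at n x)"
  have "inj_on ?f (pegs 1)"
    using c hanoi_adj_smallest_disc_at[OF assms(1)] smallest_disc_at_in_hanoi_verts
    unfolding proper_colouring_def inj_on_def by metis
  moreover have "?f ` pegs 1 \<subseteq> {..<k}"
    using c smallest_disc_at_in_hanoi_verts unfolding proper_colouring_def by auto
  ultimately have "card (pegs 1) \<le> card {..<k}"
    by (intro card_inj_on_le) auto
  then show ?thesis
    by (simp add: pegs_def parity_peg_def)
qed

theorem theorem6p23:
  fixes n :: nat
  assumes "n \<ge> 1"
  shows "chromatic_number (hanoi_verts n) (hanoi_adj n) = 3"
  unfolding chromatic_number_def
  using proper_colouring_peg_sum proper_colouring_hanoi_ge_3[OF assms]
  by (blast intro: Least_equality)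

end
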